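(* Let $D\ge 1$ and let $A=(A[1],\dots,A[D])$ be a vector with $A[i]\ge 0$ for all $i$, not all zero. Let $\alpha\in(0,1)$, $\Delta=1-\alpha$, and $F_{(\alpha)}=\sum_{i=1}^D A[i]^\alpha$. Let $k\ge1$ and let $v_{ij}\sim\mathrm{Uniform}(0,\pi)$ and $w_{ij}\sim\mathrm{Exp}(1)$, $1\le i\le D$, $1\le j\le k$, all mutually independent. Define \[ r_{ij}=\frac{\sin(\alpha v_{ij})}{[\sin v_{ij}]^{1/\alpha}}\left[\frac{\sin(v_{ij}\Delta)}{w_{ij}}\right]^{\Delta/\alpha},\qquad x_j=\sum_{i=1}^D r_{ij}A[i], \] and $\hat F_{(\alpha),\min}=\left[\min\{x_1,\dots,x_k\}\right]^\alpha$. Then for any $0<\epsilon<1$, \[ \Pr\left(\hat F_{(\alpha),\min}\le (1-\epsilon)F_{(\alpha)}\right)\le k\exp\left(-\frac{\Delta\,\alpha^{1/\Delta-1}}{(1-\epsilon)^{1/\Delta}}\right). \]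
   Context: $\mathrm{Exp}(1)$ denotes the exponential distribution with mean $1$. The $r_{ij}$ are i.i.d. maximally skewed $\alpha$-stable variables with scale $\cos(\pi\alpha/2)$. *)

theory Defs
  imports "HOL-Probability.Probability"
begin

text \<open>
  The transform (due to Chambers, Mallows and Stuck) that turns \<open>v \<sim> Uniform(0, \<pi>)\<close> and
  \<open>w \<sim> Exp(1)\<close>, independent, into a maximally skewed \<open>\<alpha>\<close>-stable variable with scale
  \<open>cos (\<pi> \<alpha> / 2)\<close>; here \<open>\<Delta> = 1 - \<alpha>\<close>. All bases of powers are positive for \<open>0 < v < \<pi>\<close>
  and \<open>w > 0\<close>, that is, almost surely.
\<close>

definition skewed_stable :: "real \<Rightarrow> real \<Rightarrow> real \<Rightarrow> real" where
  "skewed_stable \<alpha> v w =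
     sin (\<alpha> * v) / sin v powr (1 / \<alpha>) * (sin (v * (1 - \<alpha>)) / w) powr ((1 - \<alpha>) / \<alpha>)"

definition freq_moment :: "real \<Rightarrow> nat \<Rightarrow> (nat \<Rightarrow> real) \<Rightarrow> real" where
  "freq_moment \<alpha> D A = (\<Sum>i=1..D. A i powr \<alpha>)"

definition projected_sample ::
  "real \<Rightarrow> nat \<Rightarrow> (nat \<Rightarrow> real) \<Rightarrow> (nat \<Rightarrow> nat \<Rightarrow> 'a \<Rightarrow> real) \<Rightarrow> (nat \<Rightarrow> nat \<Rightarrow> 'a \<Rightarrow> real)
     \<Rightarrow> nat \<Rightarrow> 'a \<Rightarrow> real" where
  "projected_sample \<alpha> D A v w j \<omega> =
     (\<Sum>i=1..D. skewed_stable \<alpha> (v i j \<omega>) (w i j \<omega>) * A i)"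

definition min_estimator ::
  "real \<Rightarrow> nat \<Rightarrow> nat \<Rightarrow> (nat \<Rightarrow> real) \<Rightarrow> (nat \<Rightarrow> nat \<Rightarrow> 'a \<Rightarrow> real) \<Rightarrow> (nat \<Rightarrow> nat \<Rightarrow> 'a \<Rightarrow> real)
     \<Rightarrow> 'a \<Rightarrow> real" where
  "min_estimator \<alpha> D k A v w \<omega> =
     (Min ((\<lambda>j. projected_sample \<alpha> D A v w j \<omega>) ` {1..k})) powr \<alpha>"

end

theory Submission
  imports Defs "HOL-Real_Asymp.Real_Asymp"
begin

text \<open>
  By Chernoff's method and independence it suffices to bound the Laplace transform of a single
  stable variable \<open>r\<close>: if \<open>E exp (- l r) \<le> exp (- l powr \<alpha>)\<close> for all \<open>l\<close>, then
  \<open>P (x\<^sub>j \<le> T) \<le> exp (l T - l powr \<alpha> F)\<close>, and minimising over \<open>l\<close> gives exactly the stated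
  exponent.

  For fixed \<open>v = \<theta>\<close> substitute \<open>w = c b exp (\<alpha> t)\<close> with \<open>c = l powr \<alpha>\<close>. Then
  \<open>l r + w = c U (t, \<theta>)\<close>, where \<open>U = a exp (- (1 - \<alpha>) t) + b exp (\<alpha> t)\<close>,
  \<open>a = sin (\<alpha> \<theta>) / sin \<theta>\<close> and \<open>b = sin ((1 - \<alpha>) \<theta>) / sin \<theta>\<close>.
  With \<open>s = exp (t + \<i> \<theta>)\<close> and \<open>h = Im (s powr \<alpha>) / Im s\<close> one has \<open>U = h (1 - s) + s powr \<alpha>\<close>,
  and the integrand is minus the divergence of a flux obtained from \<open>exp (- c U) s / (s - 1)\<close>.
  The divergence theorem on rectangles leaves, in the limit, only the side \<open>\<theta> = \<delta>\<close>, where the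
  flux is \<open>exp (- c U)\<close> times a Poisson kernel of total mass at most \<open>\<pi>\<close>. As \<open>U \<ge> 1\<close>, the
  integral is at most \<open>\<pi> exp (- c)\<close>.
\<close>

section \<open>Lower bound for the potential\<close>

text \<open>The difference of the two sides vanishes at 0 and has derivative
  \<open>a * (cos (a * y) - cos y)\<close>, which is nonnegative because cosine decreases between 0
  and pi.\<close>

lemma sin_mult_ge:
  fixes a x :: real
  assumes "0 \<le> a" "a \<le> 1" "0 \<le> x" "x \<le> pi"
  shows "a * sin x \<le> sin (a * x)"
proof -
  let ?f = "\<lambda>x. sin (a * x) - a * sin x"
  have "?f 0 \<le> ?f x"
  proof (rule DERIV_nonneg_imp_nondecreasing[OF assms(3)])
    fix y assume y: "0 \<le> y" "y \<le> x"
    have "a * y \<le> y" using assms y mult_right_mono[of a 1 y] by simp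
    then have "cos y \<le> cos (a * y)" using assms y by (intro cos_monotone_0_pi_le) auto
    then have "0 \<le> a * (cos (a * y) - cos y)" using assms by simp
    moreover have "(?f has_real_derivative a * (cos (a * y) - cos y)) (at y)"
      by (auto intro!: derivative_eq_intros simp: algebra_simps)
    ultimately show "\<exists>d. (?f has_real_derivative d) (at y) \<and> 0 \<le> d" by blast
  qed
  then show ?thesis by simp
qed

text \<open>This is \<open>U\<close> of the overview over a common denominator. For 0 < \<theta> <
  pi its minimum over t is, up to a factor depending only on \<alpha>, \<open>sin (\<alpha> *
  \<theta>) powr \<alpha> * sin ((1 - \<alpha>) * \<theta>) powr (1 - \<alpha>) / sin
  \<theta>\<close>, a power of which is the function of the angle in Kanter's representation of
  positive stable variables.\<close>

definition kanter_potential :: "real \<Rightarrow> real \<Rightarrow> real \<Rightarrow> real" where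
  "kanter_potential \<alpha> t \<theta> =
     (sin (\<alpha> * \<theta>) * exp (- (1 - \<alpha>) * t) + sin ((1 - \<alpha>) * \<theta>) * exp (\<alpha> * t)) / sin \<theta>"

text \<open>Bound both exponentials by their tangents at t = 0: with weights \<alpha> and 1 -
  \<alpha> the linear terms cancel and the constants add up to 1. By \<open>sin_mult_ge\<close> the
  actual weights are at least as large.\<close>

lemma kanter_potential_ge_1:
  assumes "0 < \<alpha>" "\<alpha> < 1" "0 < \<theta>" "\<theta> < pi"
  shows "1 \<le> kanter_potential \<alpha> t \<theta>"
proof -
  have s: "0 < sin \<theta>" using assms by (intro sin_gt_zero) auto
  have "1 = \<alpha> * (1 + - (1 - \<alpha>) * t) + (1 - \<alpha>) * (1 + \<alpha> * t)" by (simp add: algebra_simps)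
  also have "\<dots> \<le> \<alpha> * exp (- (1 - \<alpha>) * t) + (1 - \<alpha>) * exp (\<alpha> * t)"
    using assms by (intro add_mono mult_left_mono exp_ge_add_one_self) auto
  finally have "sin \<theta> \<le> (\<alpha> * exp (- (1 - \<alpha>) * t) + (1 - \<alpha>) * exp (\<alpha> * t)) * sin \<theta>"
    using s by simp
  also have "\<dots> = \<alpha> * sin \<theta> * exp (- (1 - \<alpha>) * t) + (1 - \<alpha>) * sin \<theta> * exp (\<alpha> * t)"
    by (simp add: algebra_simps)
  also have "\<dots> \<le> sin (\<alpha> * \<theta>) * exp (- (1 - \<alpha>) * t) + sin ((1 - \<alpha>) * \<theta>) * exp (\<alpha> * t)"
    using assms by (intro add_mono mult_right_mono sin_mult_ge) auto
  finally show ?thesis using s by (simp add: kanter_potential_def)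
qed

section \<open>Gradient of the potential and divergence of the fluxes\<close>

text \<open>\<open>\<bar>s - 1\<bar>\<^sup>2\<close> for \<open>s = exp (t + \<i> \<theta>)\<close>.\<close>

definition dist_one_sq :: "real \<Rightarrow> real \<Rightarrow> real" where
  "dist_one_sq t \<theta> = (exp t - cos \<theta>)\<^sup>2 + (sin \<theta>)\<^sup>2"

lemma dist_one_sq_pos: "sin \<theta> > 0 \<Longrightarrow> dist_one_sq t \<theta> > 0"
  by (simp add: dist_one_sq_def add_nonneg_pos)

lemma dist_one_sq_eq: "dist_one_sq t \<theta> = (exp t)\<^sup>2 - 2 * exp t * cos \<theta> + 1"
  unfolding dist_one_sq_def using sin_cos_squared_add[of \<theta>]
  by (simp add: power2_diff)

definition kanter_potential_dt :: "real \<Rightarrow> real \<Rightarrow> real \<Rightarrow> real" where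
  "kanter_potential_dt \<alpha> t \<theta> = (\<alpha> * sin ((1 - \<alpha>) * \<theta>) * exp (\<alpha> * t)
      - (1 - \<alpha>) * sin (\<alpha> * \<theta>) * exp (- (1 - \<alpha>) * t)) / sin \<theta>"

definition kanter_potential_dtheta :: "real \<Rightarrow> real \<Rightarrow> real \<Rightarrow> real" where
  "kanter_potential_dtheta \<alpha> t \<theta> =
     ((\<alpha> * cos (\<alpha> * \<theta>) * sin \<theta> - sin (\<alpha> * \<theta>) * cos \<theta>) * exp (- (1 - \<alpha>) * t)
      + ((1 - \<alpha>) * cos ((1 - \<alpha>) * \<theta>) * sin \<theta> - sin ((1 - \<alpha>) * \<theta>) * cos \<theta>) * exp (\<alpha> * t))
     / (sin \<theta>)\<^sup>2"

lemma DERIV_kanter_potential_t: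
  "((\<lambda>t. kanter_potential \<alpha> t \<theta>) has_real_derivative kanter_potential_dt \<alpha> t \<theta>) (at t)"
  unfolding kanter_potential_def kanter_potential_dt_def divide_inverse
  by (auto intro!: derivative_eq_intros simp: algebra_simps)

lemma DERIV_kanter_potential_theta:
  "sin \<theta> \<noteq> 0
    \<Longrightarrow> (kanter_potential \<alpha> t has_real_derivative kanter_potential_dtheta \<alpha> t \<theta>) (at \<theta>)"
  unfolding kanter_potential_def kanter_potential_dtheta_def
  by (auto intro!: derivative_eq_intros simp: field_simps power2_eq_square)

text \<open>After division by \<open>dist_one_sq t \<theta>\<close> the left side is the derivative
  of U along the field (Re f, - Im f) with f = s / (s - 1), that is, the real part of f (U_t + i
  U_theta). In U = h (1 - s) + s powr \<alpha> only h fails to be holomorphic, so the factor 1 - s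
  cancels the denominator of f and the real part of - s (h_t + i h_theta) remains, which is
  elementary.\<close>

lemma kanter_potential_gradient:
  assumes s: "sin \<theta> > 0"
  shows "kanter_potential_dtheta \<alpha> t \<theta> * (exp t * sin \<theta>)
      + kanter_potential_dt \<alpha> t \<theta> * (exp t * (exp t - cos \<theta>))
    = \<alpha> * sin ((1 - \<alpha>) * \<theta>) / sin \<theta> * exp (\<alpha> * t) * dist_one_sq t \<theta>"
proof -
  define S C S1 C1 S2 C2 E X where d: "S = sin \<theta>" "C = cos \<theta>" "S1 = sin (\<alpha> * \<theta>)" "C1 = cos (\<alpha> * \<theta>)"
   "S2 = sin ((1 - \<alpha>) * \<theta>)" "C2 = cos ((1 - \<alpha>) * \<theta>)" "E = exp (- (1 - \<alpha>) * t)" "X = exp t"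
  \<comment> \<open>With this relation only polynomials in the named quantities remain, apart from
    the denominator \<open>S\<close>.\<close>
  have EX: "exp (\<alpha> * t) = E * X" unfolding d by (simp add: exp_add[symmetric] algebra_simps)
  have e: "\<theta> = \<alpha> * \<theta> + (1 - \<alpha>) * \<theta>" by (simp add: algebra_simps)
  have S: "S = S1 * C2 + C1 * S2" and C: "C = C1 * C2 - S1 * S2"
    unfolding d by (subst e, simp only: sin_add cos_add)+
  have q1: "S1\<^sup>2 + C1\<^sup>2 = 1" and q2: "S2\<^sup>2+C2\<^sup>2 = 1" unfolding d by simp_all
  \<comment> \<open>These are the subtraction formulas for (1 - \<alpha>) \<theta> = \<theta> -
    \<alpha> \<theta> and for \<alpha> \<theta> = \<theta> - (1 - \<alpha>) \<theta>; the polynomial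
    identity \<open>*\<close> follows from them.\<close>
  have a: "S2 = S * C1 - C * S1" unfolding S C using q1 by algebra
  have b: "S1 = S * C2 - C * S2" unfolding S C using q2 by algebra
  have N: "dist_one_sq t \<theta> = X\<^sup>2 - 2 * X * C + 1" unfolding d by (rule dist_one_sq_eq)
  have *: "((\<alpha> * C1 * S - S1 * C) * E + ((1-\<alpha>) * C2 * S - S2 * C) * (E * X)) * X
      + (\<alpha> * S2 * (E * X) - (1-\<alpha>) * S1 * E) * (X * (X - C))
   = \<alpha> * S2 * (E * X) * (X\<^sup>2 - 2 * X * C + 1)"
    using a b by algebra
  have "kanter_potential_dtheta \<alpha> t \<theta> * (X * S) + kanter_potential_dt \<alpha> t \<theta> * (X * (X - C)) =
    (((\<alpha> * C1 * S - S1 * C) * E + ((1-\<alpha>) * C2 * S - S2 * C) * (E * X)) * X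
      + (\<alpha> * S2 * (E * X) - (1-\<alpha>) * S1 * E) * (X * (X - C))) / S"
    using s unfolding kanter_potential_dtheta_def kanter_potential_dt_def EX d[symmetric]
        by (simp add: divide_simps power2_eq_square)
  also note *
  finally show ?thesis unfolding N EX unfolding d by simp
qed

text \<open>
  The second factors of the two fluxes are \<open>- Im\<close> and \<open>Re\<close> of \<open>s / (s - 1)\<close>, which is
  holomorphic in \<open>t + \<i> \<theta>\<close>: by the Cauchy-Riemann equations their own divergence vanishes, so
  that only the derivatives of the exponential contribute to the divergence of the fluxes.
\<close>

definition flux_theta :: "real \<Rightarrow> real \<Rightarrow> real \<Rightarrow> real \<Rightarrow> real" where
  "flux_theta c \<alpha> t \<theta> = exp (- (c * kanter_potential \<alpha> t \<theta>)) * (exp t * sin \<theta> / dist_one_sq t \<theta>)"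

definition flux_t :: "real \<Rightarrow> real \<Rightarrow> real \<Rightarrow> real \<Rightarrow> real" where
  "flux_t c \<alpha> t \<theta> = exp (- (c * kanter_potential \<alpha> t \<theta>))
      * (exp t * (exp t - cos \<theta>) / dist_one_sq t \<theta>)"

definition flux_theta_dtheta :: "real \<Rightarrow> real \<Rightarrow> real \<Rightarrow> real \<Rightarrow> real" where
  "flux_theta_dtheta c \<alpha> t \<theta> = exp (- (c * kanter_potential \<alpha> t \<theta>)) *
     ((exp t * (cos \<theta> * dist_one_sq t \<theta> - 2 * exp t * (sin \<theta>)\<^sup>2)) / (dist_one_sq t \<theta>)\<^sup>2
      - c * kanter_potential_dtheta \<alpha> t \<theta> * (exp t * sin \<theta>) / dist_one_sq t \<theta>)"

definition flux_t_dt :: "real \<Rightarrow> real \<Rightarrow> real \<Rightarrow> real \<Rightarrow> real" where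
  "flux_t_dt c \<alpha> t \<theta> = exp (- (c * kanter_potential \<alpha> t \<theta>)) *
     ((exp t * (2 * exp t - cos \<theta>) * dist_one_sq t \<theta> - 2 * (exp t * (exp t - cos \<theta>))\<^sup>2)
        / (dist_one_sq t \<theta>)\<^sup>2
      - c * kanter_potential_dt \<alpha> t \<theta> * (exp t * (exp t - cos \<theta>)) / dist_one_sq t \<theta>)"

text \<open>\<open>exp (- l r - w) dw\<close> in the coordinate \<open>t\<close>, where \<open>c = l powr \<alpha>\<close>.\<close>

definition polar_density :: "real \<Rightarrow> real \<Rightarrow> real \<Rightarrow> real \<Rightarrow> real" where
  "polar_density c \<alpha> t \<theta> = c * (\<alpha> * sin ((1 - \<alpha>) * \<theta>) / sin \<theta> * exp (\<alpha> * t))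
      * exp (- (c * kanter_potential \<alpha> t \<theta>))"

lemma DERIV_dist_one_sq_theta: "(dist_one_sq t has_real_derivative 2 * exp t * sin \<theta>) (at \<theta>)"
  unfolding dist_one_sq_eq[abs_def] by (auto intro!: derivative_eq_intros)

lemma DERIV_dist_one_sq_t:
  "((\<lambda>t. dist_one_sq t \<theta>) has_real_derivative 2 * exp t * (exp t - cos \<theta>)) (at t)"
  unfolding dist_one_sq_def[abs_def] by (auto intro!: derivative_eq_intros)

lemma DERIV_flux_theta:
  assumes "sin \<theta> > 0"
  shows "(flux_theta c \<alpha> t has_real_derivative flux_theta_dtheta c \<alpha> t \<theta>) (at \<theta>)"
proof -
  have N: "dist_one_sq t \<theta> > 0" using assms by (rule dist_one_sq_pos)
  show ?thesis
    unfolding flux_theta_def[abs_def]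
    by (rule derivative_eq_intros refl DERIV_dist_one_sq_theta DERIV_kanter_potential_theta
        | use assms N in simp; fail)+
      (use N in \<open>simp add: flux_theta_dtheta_def field_simps power2_eq_square\<close>)
qed

lemma DERIV_flux_t:
  assumes "sin \<theta> > 0"
  shows "((\<lambda>t. flux_t c \<alpha> t \<theta>) has_real_derivative flux_t_dt c \<alpha> t \<theta>) (at t)"
proof -
  have N: "dist_one_sq t \<theta> > 0" using assms by (rule dist_one_sq_pos)
  show ?thesis
    unfolding flux_t_def[abs_def]
    by (rule derivative_eq_intros refl DERIV_dist_one_sq_t DERIV_kanter_potential_t
        | use assms N in simp; fail)+
      (use N in \<open>simp add: flux_t_dt_def field_simps power2_eq_square\<close>)
qed

text \<open>The derivatives of the two rational factors cancel. What is left of the divergence is -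
  c exp (- c U) times the derivative of U along the field, which
  \<open>kanter_potential_gradient\<close> evaluates.\<close>

lemma polar_density_eq_divergence:
  assumes "sin \<theta> > 0"
  shows "polar_density c \<alpha> t \<theta> = - flux_t_dt c \<alpha> t \<theta> - flux_theta_dtheta c \<alpha> t \<theta>"
proof -
  define N where "N = dist_one_sq t \<theta>"
  have N: "N > 0" unfolding N_def using assms by (rule dist_one_sq_pos)
  \<comment> \<open>The Cauchy-Riemann equations for s / (s - 1), with the denominator
    \<open>N\<^sup>2\<close> cleared.\<close>
  have 1: "exp t * (2 * exp t - cos \<theta>) * N - 2 * (exp t * (exp t - cos \<theta>))\<^sup>2 +
     exp t * (cos \<theta> * N - 2 * exp t * (sin \<theta>)\<^sup>2) = 0"
    unfolding N_def dist_one_sq_def by (simp add: algebra_simps power2_eq_square)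
  have 2: "exp t * (2 * exp t - cos \<theta>) * N - 2 * (exp t * (exp t - cos \<theta>))\<^sup>2 =
     - (exp t * (cos \<theta> * N - 2 * exp t * (sin \<theta>)\<^sup>2))"
    using 1 by linarith
  show ?thesis
    unfolding polar_density_def flux_t_dt_def flux_theta_dtheta_def N_def[symmetric] 2
    using kanter_potential_gradient[OF assms, of \<alpha> t, folded N_def] N
    by (simp add: field_simps) algebra
qed

text \<open>Arbitrary continuous f and g let the same facts serve for slices in one variable and for
  the whole rectangle.\<close>

lemma continuous_on_polar_terms:
  fixes f g :: "'a::t2_space \<Rightarrow> real"
  assumes "\<And>x. x \<in> S \<Longrightarrow> sin (g x) > 0" "continuous_on S f" "continuous_on S g"
  shows "continuous_on S (\<lambda>x. flux_theta_dtheta c \<alpha> (f x) (g x))"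
    and "continuous_on S (\<lambda>x. flux_t_dt c \<alpha> (f x) (g x))"
    and "continuous_on S (\<lambda>x. flux_theta c \<alpha> (f x) (g x))"
    and "continuous_on S (\<lambda>x. flux_t c \<alpha> (f x) (g x))"
    and "continuous_on S (\<lambda>x. polar_density c \<alpha> (f x) (g x))"
proof -
  have N: "dist_one_sq (f x) (g x) \<noteq> 0" if "x \<in> S" for x
    using dist_one_sq_pos[OF assms(1)[OF that], of "f x"] by simp
  have s: "sin (g x) \<noteq> 0" if "x \<in> S" for x using assms(1)[OF that] by simp
  have c: "continuous_on S (\<lambda>x. dist_one_sq (f x) (g x))"
    unfolding dist_one_sq_def by (intro continuous_intros assms(2,3))
  have c2: "continuous_on S (\<lambda>x. kanter_potential \<alpha> (f x) (g x))"
       "continuous_on S (\<lambda>x. kanter_potential_dt \<alpha> (f x) (g x))"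
       "continuous_on S (\<lambda>x. kanter_potential_dtheta \<alpha> (f x) (g x))"
    unfolding kanter_potential_def kanter_potential_dt_def kanter_potential_dtheta_def
    by (intro continuous_intros assms(2,3); use s in simp)+
  show "continuous_on S (\<lambda>x. flux_theta_dtheta c \<alpha> (f x) (g x))"
     "continuous_on S (\<lambda>x. flux_t_dt c \<alpha> (f x) (g x))"
     "continuous_on S (\<lambda>x. flux_theta c \<alpha> (f x) (g x))"
     "continuous_on S (\<lambda>x. flux_t c \<alpha> (f x) (g x))"
     "continuous_on S (\<lambda>x. polar_density c \<alpha> (f x) (g x))"
    unfolding flux_theta_dtheta_def flux_t_dt_def flux_theta_def flux_t_def polar_density_def
    by (intro continuous_intros assms(2,3) c c2; use s N in simp)+
qed

section \<open>The divergence theorem on rectangles\<close>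

text \<open>In the variable exp t the integrand is pi times a Cauchy density with centre cos
  \<theta> and scale sin \<theta>, so an arctangent is its antiderivative. The bound is uniform in
  \<theta> and T.\<close>

lemma poisson_integral_le:
  assumes s: "sin \<theta> > 0" and "T \<ge> 0"
  shows "integral {-T..T} (\<lambda>t. exp t * sin \<theta> / dist_one_sq t \<theta>) \<le> pi"
proof -
  let ?F = "\<lambda>t. arctan ((exp t - cos \<theta>) / sin \<theta>)"
  have "((\<lambda>t. exp t * sin \<theta> / dist_one_sq t \<theta>) has_integral ?F T - ?F (-T)) {-T..T}"
  proof (rule fundamental_theorem_of_calculus)
    fix t assume "t \<in> {-T..T}"
    have "(?F has_real_derivative exp t * sin \<theta> / dist_one_sq t \<theta>) (at t)"
      using s dist_one_sq_pos[OF s, of t]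
      by (auto intro!: derivative_eq_intros simp: dist_one_sq_def divide_simps)
         (simp add: power2_eq_square algebra_simps)
    then show "(?F has_vector_derivative exp t * sin \<theta> / dist_one_sq t \<theta>) (at t within {-T..T})"
      using has_real_derivative_iff_has_vector_derivative has_vector_derivative_at_within by blast
  qed (use assms in auto)
  then have "integral {-T..T} (\<lambda>t. exp t * sin \<theta> / dist_one_sq t \<theta>) = ?F T - ?F (-T)"
    by (rule integral_unique)
  also have "\<dots> \<le> pi"
    using arctan_ubound[of "(exp T - cos \<theta>) / sin \<theta>"] arctan_lbound[of "(exp (-T) - cos \<theta>) / sin \<theta>"]
    by linarith
  finally show ?thesis .
qed

text \<open>The double integral equals the flux through the four sides. Those at \<theta> = \<eta>
  and t = T have a favourable sign and are dropped, the one at t = - T gives the error term, and the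
  one at \<theta> = \<delta> gives \<open>pi * exp (- c)\<close>.\<close>

lemma polar_density_rectangle:
  assumes a: "0 < \<alpha>" "\<alpha> < 1" and c: "c \<ge> 0" and T: "T > 0" and d: "0 < \<delta>" "\<delta> \<le> \<eta>" "\<eta> < pi"
  shows "integral {\<delta>..\<eta>} (\<lambda>\<theta>. integral {-T..T} (\<lambda>t. polar_density c \<alpha> t \<theta>))
         \<le> pi * exp (- c) + pi * (exp (-T) / (1 - exp (-T)))"
proof -
  let ?r = "exp (-T) / (1 - exp (-T))"
  have s: "sin \<theta> > 0" if "\<theta> \<in> {\<delta>..\<eta>}" for \<theta>
    using that d by (intro sin_gt_zero) auto
  have s': "sin (fst x) > 0" if "x \<in> {\<delta>..\<eta>} \<times> {-T..T}" for x
    using s that by auto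
  have U: "1 \<le> kanter_potential \<alpha> t \<theta>" if "\<theta> \<in> {\<delta>..\<eta>}" for t \<theta>
    using that d a by (intro kanter_potential_ge_1) auto
  have E: "exp (- (c * kanter_potential \<alpha> t \<theta>)) \<le> exp (-c)" if "\<theta> \<in> {\<delta>..\<eta>}" for t \<theta>
    using mult_left_mono[OF U[OF that] c] by simp
  have E1: "exp (- (c * kanter_potential \<alpha> t \<theta>)) \<le> 1" if "\<theta> \<in> {\<delta>..\<eta>}" for t \<theta>
    using E[OF that, of t] c by (smt (verit) exp_le_one_iff)
  have cont: "continuous_on {-T..T} (\<lambda>t. flux_t_dt c \<alpha> t \<theta>)"
    "continuous_on {-T..T} (\<lambda>t. flux_theta_dtheta c \<alpha> t \<theta>)" if "\<theta> \<in> {\<delta>..\<eta>}" for \<theta>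
    using s[OF that] by (intro continuous_on_polar_terms continuous_intros; simp)+
  have cont_th: "continuous_on {\<delta>..\<eta>} (\<lambda>\<theta>. flux_t c \<alpha> t \<theta>)" for t
    using s by (intro continuous_on_polar_terms continuous_intros) simp
  have cont_flux: "continuous_on {-T..T} (\<lambda>t. flux_theta c \<alpha> t \<theta>)" if "\<theta> \<in> {\<delta>..\<eta>}" for \<theta>
    using s[OF that] by (intro continuous_on_polar_terms continuous_intros; simp)+
  have dt: "integral {-T..T} (\<lambda>t. flux_t_dt c \<alpha> t \<theta>) = flux_t c \<alpha> T \<theta> - flux_t c \<alpha> (-T) \<theta>"
    if "\<theta> \<in> {\<delta>..\<eta>}" for \<theta>
    using DERIV_flux_t[OF s[OF that]] T
    by (intro integral_unique fundamental_theorem_of_calculus)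
       (auto simp: has_real_derivative_iff_has_vector_derivative
           intro: has_vector_derivative_at_within)
  have dth: "integral {\<delta>..\<eta>} (\<lambda>\<theta>. flux_theta_dtheta c \<alpha> t \<theta>) = flux_theta c \<alpha> t \<eta>
      - flux_theta c \<alpha> t \<delta>" for t
    using DERIV_flux_theta[OF s] d
    by (intro integral_unique fundamental_theorem_of_calculus)
       (auto simp: has_real_derivative_iff_has_vector_derivative
           intro: has_vector_derivative_at_within)
  have c2: "continuous_on ({\<delta>..\<eta>} \<times> {-T..T}) (\<lambda>x. flux_theta_dtheta c \<alpha> (snd x) (fst x))"
    using s' by (intro continuous_on_polar_terms continuous_intros; blast)
  have c2': "continuous_on {\<delta>..\<eta>} (\<lambda>\<theta>. integral {-T..T} (\<lambda>t. flux_theta_dtheta c \<alpha> t \<theta>))"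
    using integral_continuous_on_param[of "{\<delta>..\<eta>}" "-T" T "\<lambda>\<theta> t. flux_theta_dtheta c \<alpha> t \<theta>"] c2
    by (simp add: case_prod_beta')
  \<comment> \<open>The exchange lets the \<theta>-derivative be integrated in \<theta>
    first.\<close>
  have swap: "integral {\<delta>..\<eta>} (\<lambda>\<theta>. integral {-T..T} (\<lambda>t. flux_theta_dtheta c \<alpha> t \<theta>))
     = integral {-T..T} (\<lambda>t. integral {\<delta>..\<eta>} (\<lambda>\<theta>. flux_theta_dtheta c \<alpha> t \<theta>))"
    using integral_swap_continuous[of \<delta> "-T" \<eta> T "\<lambda>\<theta> t. flux_theta_dtheta c \<alpha> t \<theta>"] c2
    by (simp add: case_prod_beta' cbox_Pair_eq)
  have in1: "\<delta> \<in> {\<delta>..\<eta>}" "\<eta> \<in> {\<delta>..\<eta>}" using d by auto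
  have N0: "dist_one_sq t \<theta> \<ge> 0" for t \<theta> by (simp add: dist_one_sq_def)
  have ft0: "flux_t c \<alpha> T \<theta> \<ge> 0" if "\<theta> \<in> {\<delta>..\<eta>}" for \<theta>
  proof -
    have "cos \<theta> \<le> exp T" using T by (intro order_trans[OF cos_le_one]) simp
    then show ?thesis using N0[of T \<theta>] by (simp add: flux_t_def)
  qed
  \<comment> \<open>The side t = - T: the bound does not depend on \<theta> and tends to 0 as T
    grows.\<close>
  have ft1: "flux_t c \<alpha> (-T) \<theta> \<le> ?r" if "\<theta> \<in> {\<delta>..\<eta>}" for \<theta>
  proof -
    define X u where "X = exp (-T)" and "u = cos \<theta>"
    have X: "0 < X" "X < 1" unfolding X_def using T by auto
    have N: "dist_one_sq (-T) \<theta> = X\<^sup>2 - 2 * X * u + 1" unfolding X_def u_def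
        by (rule dist_one_sq_eq)
    have Np: "dist_one_sq (-T) \<theta> > 0" using s[OF that] by (rule dist_one_sq_pos)
    have u: "- 1 \<le> u" "u \<le> 1" unfolding u_def by auto
    \<comment> \<open>The wanted difference X^2 - 2 X u + 1 - (X - u) (1 - X) is affine in u. It
      equals 2 X^2 + 2 X at u = - 1 and 2 (1 - X)^2 at u = 1; interpolating between these gives the
      expression here, which is twice the difference.\<close>
    have "(1 - u) * (2 * X\<^sup>2 + 2 * X) + (1 + u) * (2 * (1 - X)\<^sup>2) \<ge> 0"
      by (intro add_nonneg_nonneg[OF mult_nonneg_nonneg mult_nonneg_nonneg]) (use u X in auto)
    then have "(X - u) * (1 - X) \<le> X\<^sup>2 - 2 * X * u + 1"
      by (simp add: algebra_simps power2_eq_square)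
    then have "X * ((X - u) * (1 - X)) \<le> X * dist_one_sq (-T) \<theta>"
      unfolding N using X by (intro mult_left_mono) auto
    then have "X * (X - u) / dist_one_sq (-T) \<theta> \<le> X / (1 - X)"
      using X Np by (simp add: field_simps)
    moreover have "0 \<le> X / (1 - X)" using X by simp
    ultimately have "exp (- (c * kanter_potential \<alpha> (-T) \<theta>)) * (X * (X - u) / dist_one_sq (-T) \<theta>)
        \<le> 1 * (X / (1 - X))"
      using E1[OF that, of "-T"]
      by (intro order_trans[OF mult_left_mono mult_right_mono]) auto
    then show ?thesis by (simp add: flux_t_def X_def u_def)
  qed
  have "integral {\<delta>..\<eta>} (\<lambda>\<theta>. integral {-T..T} (\<lambda>t. polar_density c \<alpha> t \<theta>)) =
     integral {\<delta>..\<eta>} (\<lambda>\<theta>. (flux_t c \<alpha> (-T) \<theta> - flux_t c \<alpha> T \<theta>)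
         - integral {-T..T} (\<lambda>t. flux_theta_dtheta c \<alpha> t \<theta>))"
  proof (rule integral_cong)
    fix \<theta> assume th: "\<theta> \<in> {\<delta>..\<eta>}"
    have "integral {-T..T} (\<lambda>t. polar_density c \<alpha> t \<theta>)
        = integral {-T..T} (\<lambda>t. - flux_t_dt c \<alpha> t \<theta> - flux_theta_dtheta c \<alpha> t \<theta>)"
      using polar_density_eq_divergence[OF s[OF th]] by simp
    also have "\<dots> = integral {-T..T} (\<lambda>t. - flux_t_dt c \<alpha> t \<theta>)
        - integral {-T..T} (\<lambda>t. flux_theta_dtheta c \<alpha> t \<theta>)"
      using cont[OF th] by (intro integral_diff integrable_continuous_interval continuous_intros)
    finally show "integral {-T..T} (\<lambda>t. polar_density c \<alpha> t \<theta>)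
        = (flux_t c \<alpha> (-T) \<theta> - flux_t c \<alpha> T \<theta>) - integral {-T..T} (\<lambda>t. flux_theta_dtheta c \<alpha> t \<theta>)"
      using dt[OF th] by simp
  qed
  also have "\<dots> = integral {\<delta>..\<eta>} (\<lambda>\<theta>. flux_t c \<alpha> (-T) \<theta> - flux_t c \<alpha> T \<theta>)
     - integral {\<delta>..\<eta>} (\<lambda>\<theta>. integral {-T..T} (\<lambda>t. flux_theta_dtheta c \<alpha> t \<theta>))"
    using cont_th c2' by (intro integral_diff integrable_continuous_interval continuous_intros)
  finally have split: "integral {\<delta>..\<eta>} (\<lambda>\<theta>. integral {-T..T} (\<lambda>t. polar_density c \<alpha> t \<theta>)) =
     integral {\<delta>..\<eta>} (\<lambda>\<theta>. flux_t c \<alpha> (-T) \<theta> - flux_t c \<alpha> T \<theta>)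
     - integral {\<delta>..\<eta>} (\<lambda>\<theta>. integral {-T..T} (\<lambda>t. flux_theta_dtheta c \<alpha> t \<theta>))" .
  have "integral {\<delta>..\<eta>} (\<lambda>\<theta>. flux_t c \<alpha> (-T) \<theta> - flux_t c \<alpha> T \<theta>) \<le> integral {\<delta>..\<eta>} (\<lambda>\<theta>. ?r)"
  proof (intro integral_le integrable_continuous_interval continuous_intros cont_th)
    fix \<theta> assume "\<theta> \<in> {\<delta>..\<eta>}"
    then show "flux_t c \<alpha> (-T) \<theta> - flux_t c \<alpha> T \<theta> \<le> ?r" using ft0 ft1 by fastforce
  qed
  also have "integral {\<delta>..\<eta>} (\<lambda>\<theta>. ?r) \<le> pi * ?r"
    using d T by (simp add: divide_right_mono)
  finally have t_part: "integral {\<delta>..\<eta>} (\<lambda>\<theta>. flux_t c \<alpha> (-T) \<theta> - flux_t c \<alpha> T \<theta>) \<le> pi * ?r" .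
  have "- integral {\<delta>..\<eta>} (\<lambda>\<theta>. integral {-T..T} (\<lambda>t. flux_theta_dtheta c \<alpha> t \<theta>)) =
     integral {-T..T} (\<lambda>t. flux_theta c \<alpha> t \<delta> - flux_theta c \<alpha> t \<eta>)"
    unfolding swap dth integral_neg[symmetric] by simp
  \<comment> \<open>The flux at \<eta> is nonnegative and is dropped; at \<delta> the bound U \<ge>
    1 extracts \<open>exp (- c)\<close> and leaves the Poisson kernel.\<close>
  also have "\<dots> \<le> integral {-T..T} (\<lambda>t. exp (-c) * (exp t * sin \<delta> / dist_one_sq t \<delta>))"
  proof (intro integral_le integrable_continuous_interval continuous_intros cont_flux in1)
    have "dist_one_sq t \<delta> \<noteq> 0" for t using dist_one_sq_pos[OF s[OF in1(1)], of t] by simp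
    then show "continuous_on {-T..T} (\<lambda>t. dist_one_sq t \<delta>)" "\<forall>t\<in>{-T..T}. dist_one_sq t \<delta> \<noteq> 0"
      unfolding dist_one_sq_def by (auto intro!: continuous_intros)
    fix t
    have "flux_theta c \<alpha> t \<eta> \<ge> 0" using s[OF in1(2)] N0[of t \<eta>] by (simp add: flux_theta_def)
    moreover have "flux_theta c \<alpha> t \<delta> \<le> exp (-c) * (exp t * sin \<delta> / dist_one_sq t \<delta>)"
      unfolding flux_theta_def using E[OF in1(1), of t] N0[of t \<delta>] s[OF in1(1)]
          by (intro mult_right_mono) auto
    ultimately show "flux_theta c \<alpha> t \<delta> - flux_theta c \<alpha> t \<eta>
        \<le> exp (-c) * (exp t * sin \<delta> / dist_one_sq t \<delta>)" by linarith
  qed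
  also have "\<dots> \<le> exp (-c) * pi"
    using poisson_integral_le[OF s[OF in1(1)], of T] T by (subst integral_mult_right) simp
  finally show ?thesis using split t_part by (simp add: mult.commute)
qed

section \<open>Return to the variable w and passage to the limit\<close>

text \<open>Under this substitution the powers of sin \<theta> in the stable variable combine to 1 /
  sin \<theta>, and \<open>l * l powr (\<alpha> - 1)\<close> is again c, so that both summands share
  the factor c.\<close>

lemma skewed_stable_polar:
  fixes \<alpha> \<theta> l t :: real
  assumes a: "0 < \<alpha>" "\<alpha> < 1" and l: "l > 0" and th: "0 < \<theta>" "\<theta> < pi"
  defines "c \<equiv> l powr \<alpha>"
  defines "w \<equiv> c * (sin ((1 - \<alpha>) * \<theta>) / sin \<theta> * exp (\<alpha> * t))"
  shows "l * skewed_stable \<alpha> \<theta> w + w = c * kanter_potential \<alpha> t \<theta>"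
proof -
  have s: "sin \<theta> > 0" using th by (intro sin_gt_zero) auto
  have "(1 - \<alpha>) * \<theta> \<le> 1 * \<theta>" using a th by (intro mult_right_mono) auto
  then have "0 < (1 - \<alpha>) * \<theta>" "(1 - \<alpha>) * \<theta> < pi" using a th by (simp, linarith)
  then have s2: "sin ((1 - \<alpha>) * \<theta>) > 0" by (intro sin_gt_zero) auto
  have c: "c > 0" using l unfolding c_def by simp
  have e: "(1 - \<alpha>) / \<alpha> = 1 / \<alpha> - 1" using a by (simp add: field_simps)
  have "sin (\<theta> * (1 - \<alpha>)) / w = sin \<theta> * (exp (-\<alpha> * t) * l powr (-\<alpha>))"
    unfolding w_def c_def using s s2 l by (simp add: exp_minus powr_minus field_simps mult.commute)
  then have "(sin (\<theta> * (1 - \<alpha>)) / w) powr ((1 - \<alpha>) / \<alpha>)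
    = sin \<theta> powr (1 / \<alpha> - 1) * (exp (-\<alpha> * t) powr ((1 - \<alpha>) / \<alpha>) * (l powr (-\<alpha>)) powr ((1 - \<alpha>) / \<alpha>))"
    using s l by (simp add: powr_mult e)
  also have "exp (-\<alpha> * t) powr ((1 - \<alpha>) / \<alpha>) = exp (- (1 - \<alpha>) * t)"
    using a by (simp add: powr_def field_simps)
  also have "(l powr (-\<alpha>)) powr ((1 - \<alpha>) / \<alpha>) = l powr (\<alpha> - 1)"
    using a by (simp add: powr_powr)
  also have "sin \<theta> powr (1 / \<alpha> - 1) = sin \<theta> powr (1 / \<alpha>) / sin \<theta>"
    using s by (simp add: powr_diff)
  finally have "l * skewed_stable \<alpha> \<theta> w
      = (l * l powr (\<alpha> - 1)) * (sin (\<alpha> * \<theta>) / sin \<theta> * exp (- (1 - \<alpha>) * t))"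
    using s by (simp add: skewed_stable_def)
  also have "l * l powr (\<alpha> - 1) = c" using l by (simp add: c_def powr_diff)
  finally show ?thesis
    by (simp add: w_def kanter_potential_def algebra_simps add_divide_distrib)
qed

lemma measurable_skewed_stable [measurable (raw)]:
  assumes [measurable]: "f \<in> borel_measurable M" "g \<in> borel_measurable M"
  shows "(\<lambda>x. skewed_stable \<alpha> (f x) (g x)) \<in> borel_measurable M"
  unfolding skewed_stable_def by measurable

text \<open>The integrand is continuous and nonnegative on the compact rectangle, so the bound of
  \<open>polar_density_rectangle\<close> carries over to iterated Lebesgue integrals.\<close>

lemma nn_integral_polar_density_rectangle:
  assumes a: "0 < \<alpha>" "\<alpha> < 1" and c: "c \<ge> 0" and T: "T > 0" and d: "0 < \<delta>" "\<delta> \<le> \<eta>" "\<eta> < pi"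
  shows "(\<integral>\<^sup>+\<theta>. (\<integral>\<^sup>+t. ennreal (polar_density c \<alpha> t \<theta>) * indicator {-T..T} t \<partial>lborel)
      * indicator {\<delta>..\<eta>} \<theta> \<partial>lborel)
         \<le> ennreal (pi * exp (- c) + pi * (exp (-T) / (1 - exp (-T))))"
proof -
  have s: "sin \<theta> > 0" if "\<theta> \<in> {\<delta>..\<eta>}" for \<theta>
    using that d by (intro sin_gt_zero) auto
  have nonneg: "polar_density c \<alpha> t \<theta> \<ge> 0" if "\<theta> \<in> {\<delta>..\<eta>}" for t \<theta>
    using order_trans[OF _ sin_mult_ge[of "1 - \<alpha>" \<theta>]] a c s[OF that] that d
        by (simp add: polar_density_def)
  have cont: "continuous_on ({\<delta>..\<eta>} \<times> {-T..T}) (\<lambda>x. polar_density c \<alpha> (snd x) (fst x))"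
    using s by (intro continuous_on_polar_terms continuous_intros) auto
  have cont_t: "continuous_on {-T..T} (\<lambda>t. polar_density c \<alpha> t \<theta>)" if "\<theta> \<in> {\<delta>..\<eta>}" for \<theta>
    using s[OF that] by (intro continuous_on_polar_terms continuous_intros) auto
  let ?I = "\<lambda>\<theta>. integral {-T..T} (\<lambda>t. polar_density c \<alpha> t \<theta>)"
  have contI: "continuous_on {\<delta>..\<eta>} ?I"
    using integral_continuous_on_param[of "{\<delta>..\<eta>}" "-T" T "\<lambda>\<theta> t. polar_density c \<alpha> t \<theta>"] cont
    by (simp add: case_prod_beta')
  have "(\<integral>\<^sup>+t. ennreal (polar_density c \<alpha> t \<theta>) * indicator {-T..T} t \<partial>lborel) = ennreal (?I \<theta>)"
    if "\<theta> \<in> {\<delta>..\<eta>}" for \<theta>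
    using that cont_t
    by (intro nn_integral_has_integral_lebesgue' nonneg integrable_integral
        integrable_continuous_interval) auto
  then have "(\<integral>\<^sup>+\<theta>. (\<integral>\<^sup>+t. ennreal (polar_density c \<alpha> t \<theta>) * indicator {-T..T} t \<partial>lborel)
      * indicator {\<delta>..\<eta>} \<theta> \<partial>lborel)
     = (\<integral>\<^sup>+\<theta>. ennreal (?I \<theta>) * indicator {\<delta>..\<eta>} \<theta> \<partial>lborel)"
    by (intro nn_integral_cong) (auto simp: indicator_def)
  also have "\<dots> = ennreal (integral {\<delta>..\<eta>} ?I)"
    using contI nonneg
    by (intro nn_integral_has_integral_lebesgue' integrable_integral
        integrable_continuous_interval integral_nonneg cont_t) auto
  also have "\<dots> \<le> ennreal (pi * exp (- c) + pi * (exp (-T) / (1 - exp (-T))))"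
    using polar_density_rectangle[OF assms] by (rule ennreal_leI)
  finally show ?thesis .
qed

text \<open>Since g' = \<alpha> g, the Jacobian supplies exactly the factor of
  \<open>polar_density\<close> in front of the exponential.\<close>

lemma nn_integral_skewed_stable_substitution:
  assumes a: "0 < \<alpha>" "\<alpha> < 1" and l: "l > 0" and th: "0 < \<theta>" "\<theta> < pi" and T: "T \<ge> 0"
  defines "c \<equiv> l powr \<alpha>"
  defines "g \<equiv> \<lambda>t. c * (sin ((1 - \<alpha>) * \<theta>) / sin \<theta> * exp (\<alpha> * t))"
  shows "(\<integral>\<^sup>+w. ennreal (exp (- (l * skewed_stable \<alpha> \<theta> w)) * exp (- w))
      * indicator {g (-T)..g T} w \<partial>lborel)
    = (\<integral>\<^sup>+t. ennreal (polar_density c \<alpha> t \<theta>) * indicator {-T..T} t \<partial>lborel)"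
proof -
  have s: "sin \<theta> > 0" using th by (intro sin_gt_zero) auto
  have s2: "sin ((1 - \<alpha>) * \<theta>) \<ge> 0"
    using order_trans[OF _ sin_mult_ge[of "1 - \<alpha>" \<theta>]] a th s by simp
  let ?g' = "\<lambda>t. \<alpha> * g t"
  have "(\<integral>\<^sup>+w. ennreal (exp (- (l * skewed_stable \<alpha> \<theta> w)) * exp (- w)) * indicator {g (-T)..g T} w
      \<partial>lborel)
    = (\<integral>\<^sup>+w. ennreal (exp (- (l * skewed_stable \<alpha> \<theta> w)) * exp (- w) *
        indicator {g (-T)..g T} w) \<partial>lborel)"
    by (intro nn_integral_cong) (auto simp: indicator_def)
  also have "\<dots> = (\<integral>\<^sup>+t. ennreal (exp (- (l * skewed_stable \<alpha> \<theta> (g t))) * exp (- g t) * ?g' t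
      * indicator {-T..T} t) \<partial>lborel)"
  proof (rule nn_integral_substitution)
    show "set_borel_measurable borel {g (- T)..g T} (\<lambda>w. exp (- (l * skewed_stable \<alpha> \<theta> w))
        * exp (- w))"
      unfolding set_borel_measurable_def by measurable
    show "(g has_real_derivative ?g' x) (at x)" for x
      unfolding g_def using s by (auto intro!: derivative_eq_intros)
    show "continuous_on {-T..T} ?g'" unfolding g_def by (intro continuous_intros) (use s in auto)
    show "?g' x \<ge> 0" for x using a s s2 by (simp add: g_def c_def)
  qed (use T in simp)
  also have "\<dots> = (\<integral>\<^sup>+t. ennreal (polar_density c \<alpha> t \<theta>) * indicator {-T..T} t \<partial>lborel)"
  proof (intro nn_integral_cong)
    fix t
    have "exp (- (l * skewed_stable \<alpha> \<theta> (g t))) * exp (- g t)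
        = exp (- (l * skewed_stable \<alpha> \<theta> (g t) + g t))"
      by (simp add: exp_add[symmetric])
    also have "\<dots> = exp (- (c * kanter_potential \<alpha> t \<theta>))"
      unfolding g_def c_def using skewed_stable_polar[OF a l th, of t] by simp
    finally show "ennreal (exp (- (l * skewed_stable \<alpha> \<theta> (g t))) * exp (- g t) * ?g' t
        * indicator {-T..T} t)
        = ennreal (polar_density c \<alpha> t \<theta>) * indicator {-T..T} t"
      by (auto simp: indicator_def polar_density_def g_def mult_ac)
  qed
  finally show ?thesis .
qed

text \<open>The rectangles exhaust the domain and their error terms vanish. As only an upper bound
  is wanted, Fatou's lemma, once in w and once in \<theta>, carries out the limit.\<close>

lemma nn_integral_skewed_stable_le:
  assumes a: "0 < \<alpha>" "\<alpha> < 1" and l: "l > 0"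
  shows "(\<integral>\<^sup>+\<theta>. (\<integral>\<^sup>+w. ennreal (exp (- (l * skewed_stable \<alpha> \<theta> w)) * exp (- w))
      * indicator {0<..} w \<partial>lborel) * indicator {0<..<pi} \<theta> \<partial>lborel)
    \<le> ennreal (pi * exp (- (l powr \<alpha>)))"
proof -
  define c where "c = l powr \<alpha>"
  have c: "c > 0" using l by (simp add: c_def)
  define g where "g \<theta> t = c * (sin ((1 - \<alpha>) * \<theta>) / sin \<theta> * exp (\<alpha> * t))" for \<theta> t
  define F where "F \<theta> w = ennreal (exp (- (l * skewed_stable \<alpha> \<theta> w)) * exp (- w))" for \<theta> w
  \<comment> \<open>The shifts by 1 and 2 make \<open>T n\<close> positive and \<open>B n\<close>
    nonempty already at n = 0, where \<open>B n\<close> is the single point pi / 2.\<close>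
  define T where "T n = real (Suc n)" for n
  define B where "B n = {pi / (real n + 2)..pi - pi / (real n + 2)}" for n
  \<comment> \<open>The cut-off in w depends on \<theta>: it is the image of the t-interval. A
    conditional in place of an indicator exposes joint measurability.\<close>
  define h where "h n \<theta> w = F \<theta> w * (if g \<theta> (- T n) \<le> w \<and> w \<le> g \<theta> (T n) then 1 else 0)" for n \<theta> w
  have F_meas[measurable]: "(\<lambda>x. F (fst x) (snd x)) \<in> borel_measurable (lborel \<Otimes>\<^sub>M lborel)"
    unfolding F_def by measurable
  have h_meas: "(\<lambda>x. h n (fst x) (snd x)) \<in> borel_measurable (lborel \<Otimes>\<^sub>M lborel)" for n
    unfolding h_def g_def by measurable
  have h_meas1: "h n \<theta> \<in> borel_measurable lborel" for n \<theta>
    unfolding h_def F_def by measurable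
  have H_meas[measurable]: "(\<lambda>\<theta>. \<integral>\<^sup>+w. h n \<theta> w \<partial>lborel) \<in> borel_measurable lborel" for n
    using h_meas[of n] by (intro lborel.borel_measurable_nn_integral) (simp add: case_prod_beta')
  have B_meas[measurable]: "B n \<in> sets borel" for n by (simp add: B_def)
  have lim_h: "F \<theta> w * indicator {0<..} w \<le> liminf (\<lambda>n. h n \<theta> w)" if th: "\<theta> \<in> {0<..<pi}" for \<theta> w
  proof (cases "w > 0")
    case True
    have s: "sin \<theta> > 0" using th by (intro sin_gt_zero) auto
    have "0 < (1 - \<alpha>) * sin \<theta>" using s a by simp
    then have s2: "sin ((1 - \<alpha>) * \<theta>) > 0"
      using sin_mult_ge[of "1 - \<alpha>" \<theta>] a th by simp
    define k where "k = c * (sin ((1 - \<alpha>) * \<theta>) / sin \<theta>)"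
    have k: "k > 0" using s s2 c by (simp add: k_def)
    have g: "g \<theta> t = k * exp (\<alpha> * t)" for t by (simp add: g_def k_def)
    have "\<forall>\<^sub>F n in sequentially. k * exp (\<alpha> * T n) > w"
      unfolding T_def using k a True by real_asymp
    moreover have "\<forall>\<^sub>F n in sequentially. k * exp (\<alpha> * - T n) < w"
      unfolding T_def using k a True by real_asymp
    ultimately have "\<forall>\<^sub>F n in sequentially. F \<theta> w \<le> h n \<theta> w"
      by eventually_elim (simp add: h_def g)
    then have "F \<theta> w \<le> liminf (\<lambda>n. h n \<theta> w)" by (rule Liminf_bounded)
    then show ?thesis using True by simp
  qed simp
  have lim_B: "(\<integral>\<^sup>+w. F \<theta> w * indicator {0<..} w \<partial>lborel) * indicator {0<..<pi} \<theta>
      \<le> liminf (\<lambda>n. (\<integral>\<^sup>+w. h n \<theta> w \<partial>lborel) * indicator (B n) \<theta>)" for \<theta>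
  proof (cases "\<theta> \<in> {0<..<pi}")
    case True
    then have th: "0 < \<theta>" "\<theta> < pi" by auto
    have "\<forall>\<^sub>F n in sequentially. pi / (real n + 2) < \<theta>" using th by real_asymp
    moreover have "\<forall>\<^sub>F n in sequentially. pi / (real n + 2) < pi - \<theta>" using th by real_asymp
    ultimately have ev: "\<forall>\<^sub>F n in sequentially. (\<integral>\<^sup>+w. h n \<theta> w \<partial>lborel) \<le> (\<integral>\<^sup>+w. h n \<theta> w \<partial>lborel)
        * indicator (B n) \<theta>"
      by eventually_elim (simp add: B_def)
    have "(\<integral>\<^sup>+w. F \<theta> w * indicator {0<..} w \<partial>lborel) \<le> (\<integral>\<^sup>+w. liminf (\<lambda>n. h n \<theta> w) \<partial>lborel)"
      using lim_h[OF True] by (intro nn_integral_mono)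
    also have "\<dots> \<le> liminf (\<lambda>n. \<integral>\<^sup>+w. h n \<theta> w \<partial>lborel)"
      by (intro nn_integral_liminf h_meas1)
    also have "\<dots> \<le> liminf (\<lambda>n. (\<integral>\<^sup>+w. h n \<theta> w \<partial>lborel) * indicator (B n) \<theta>)"
      by (intro Liminf_mono ev)
    finally show ?thesis using True by simp
  qed simp
  have bound: "(\<integral>\<^sup>+\<theta>. (\<integral>\<^sup>+w. h n \<theta> w \<partial>lborel) * indicator (B n) \<theta> \<partial>lborel)
      \<le> ennreal (pi * exp (- c) + pi * (exp (- T n) / (1 - exp (- T n))))" for n
  proof -
    have d: "0 < pi / (real n + 2)" "pi / (real n + 2) \<le> pi - pi / (real n + 2)"
      "pi - pi / (real n + 2) < pi"
      by (auto simp: field_simps)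
    have "(\<integral>\<^sup>+w. h n \<theta> w \<partial>lborel) = (\<integral>\<^sup>+t. ennreal (polar_density c \<alpha> t \<theta>)
        * indicator {-T n..T n} t \<partial>lborel)"
      if "\<theta> \<in> B n" for \<theta>
    proof -
      have "0 < \<theta>" "\<theta> < pi" "T n \<ge> 0" using that d unfolding B_def T_def atLeastAtMost_iff
          by linarith+
      from nn_integral_skewed_stable_substitution[OF a l this] show ?thesis
        unfolding h_def F_def g_def c_def
        by (simp add: indicator_def of_bool_def)
    qed
    then have "(\<integral>\<^sup>+\<theta>. (\<integral>\<^sup>+w. h n \<theta> w \<partial>lborel) * indicator (B n) \<theta> \<partial>lborel)
       = (\<integral>\<^sup>+\<theta>. (\<integral>\<^sup>+t. ennreal (polar_density c \<alpha> t \<theta>) * indicator {-T n..T n} t \<partial>lborel) *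
           indicator (B n) \<theta> \<partial>lborel)"
      by (intro nn_integral_cong) (auto simp: indicator_def)
    also have "\<dots> \<le> ennreal (pi * exp (- c) + pi * (exp (- T n) / (1 - exp (- T n))))"
      unfolding B_def using a c d by (intro nn_integral_polar_density_rectangle) (auto simp: T_def)
    finally show ?thesis .
  qed
  have "(\<integral>\<^sup>+\<theta>. (\<integral>\<^sup>+w. F \<theta> w * indicator {0<..} w \<partial>lborel) * indicator {0<..<pi} \<theta> \<partial>lborel)
    \<le> (\<integral>\<^sup>+\<theta>. liminf (\<lambda>n. (\<integral>\<^sup>+w. h n \<theta> w \<partial>lborel) * indicator (B n) \<theta>) \<partial>lborel)"
    by (intro nn_integral_mono lim_B)
  also have "\<dots> \<le> liminf (\<lambda>n. \<integral>\<^sup>+\<theta>. (\<integral>\<^sup>+w. h n \<theta> w \<partial>lborel) * indicator (B n) \<theta> \<partial>lborel)"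
    by (intro nn_integral_liminf) measurable
  also have "\<dots> \<le> liminf (\<lambda>n. ennreal (pi * exp (- c) + pi * (exp (- T n) / (1 - exp (- T n)))))"
    using bound by (intro Liminf_mono always_eventually allI)
  also have "\<dots> = ennreal (pi * exp (- c))"
  proof (rule lim_imp_Liminf)
    have "(\<lambda>n. pi * exp (- c) + pi * (exp (- T n) / (1 - exp (- T n)))) \<longlonglongrightarrow> pi * exp (- c)"
      unfolding T_def by real_asymp
    then show "(\<lambda>n. ennreal (pi * exp (- c) + pi * (exp (- T n) / (1 - exp (- T n)))))
        \<longlonglongrightarrow> ennreal (pi * exp (- c))"
      by (rule tendsto_ennrealI)
  qed simp
  finally show ?thesis unfolding F_def c_def .
qed

section \<open>Laplace transforms of the stable variables and of the samples\<close>

text \<open>By independence the joint density is a product, and the uniform density 1 / pi cancels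
  the factor pi of \<open>nn_integral_skewed_stable_le\<close>. The case l = 0, where both sides are
  1, is included because entries of A may vanish.\<close>

lemma (in prob_space) skewed_stable_laplace_le:
  assumes a: "0 < \<alpha>" "\<alpha> < 1" and l: "l \<ge> 0"
    and v: "distributed M lborel v (\<lambda>x. indicator {0<..<pi} x / measure lborel {0<..<pi})"
    and w: "distributed M lborel w (exponential_density 1)"
    and ind: "indep_var borel v borel w"
  shows "(\<integral>\<^sup>+\<omega>. ennreal (exp (- (l * skewed_stable \<alpha> (v \<omega>) (w \<omega>)))) \<partial>M)
      \<le> ennreal (exp (- (l powr \<alpha>)))"
proof (cases "l = 0")
  case True
  then show ?thesis by (simp add: emeasure_space_1)
next
  case False
  then have l: "l > 0" using l by simp
  have ind': "indep_var lborel v lborel w"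
    using ind by (simp add: indep_var_eq)
  let ?p = "\<lambda>x. ennreal (indicator {0<..<pi} x / measure lborel {0<..<pi})"
  let ?q = "\<lambda>x. ennreal (exponential_density 1 x)"
  let ?G = "\<lambda>\<theta> w. ennreal (exp (- (l * skewed_stable \<alpha> \<theta> w)))"
  let ?J = "\<lambda>\<theta>. \<integral>\<^sup>+w. ennreal (exp (- (l * skewed_stable \<alpha> \<theta> w)) * exp (- w)) *
      indicator {0<..} w \<partial>lborel"
  have J[measurable]: "?J \<in> borel_measurable lborel" by measurable
  have "distributed M (lborel \<Otimes>\<^sub>M lborel) (\<lambda>\<omega>. (v \<omega>, w \<omega>)) (\<lambda>(x, y). ?p x * ?q y)"
    by (rule distributed_joint_indep[OF lborel.sigma_finite_measure_axioms
        lborel.sigma_finite_measure_axioms v w ind'])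
  from distributed_nn_integral[OF this, of "\<lambda>x. ?G (fst x) (snd x)"]
  have "(\<integral>\<^sup>+\<omega>. ?G (v \<omega>) (w \<omega>) \<partial>M) = (\<integral>\<^sup>+x. ?p (fst x) * ?q (snd x) * ?G (fst x) (snd x)
      \<partial>(lborel \<Otimes>\<^sub>M lborel))"
    by (simp add: case_prod_beta')
  also have "\<dots> = (\<integral>\<^sup>+\<theta>. \<integral>\<^sup>+w. ?p \<theta> * ?q w * ?G \<theta> w \<partial>lborel \<partial>lborel)"
    by (subst lborel.nn_integral_fst[symmetric]) simp_all
  also have "\<dots> = (\<integral>\<^sup>+\<theta>. ennreal (1 / pi) * (?J \<theta> * indicator {0<..<pi} \<theta>) \<partial>lborel)"
  proof (intro nn_integral_cong)
    fix \<theta> :: real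
    have "(\<integral>\<^sup>+w. ?p \<theta> * ?q w * ?G \<theta> w \<partial>lborel)
        = (\<integral>\<^sup>+w. ?p \<theta> * (ennreal (exp (- (l * skewed_stable \<alpha> \<theta> w)) * exp (- w))
            * indicator {0<..} w) \<partial>lborel)"
    proof (rule nn_integral_cong_AE)
      \<comment> \<open>The exponential density is nonzero at w = 0, which the open half-line
        excludes; a single point is a null set.\<close>
      show "AE w in lborel. ?p \<theta> * ?q w * ?G \<theta> w
          = ?p \<theta> * (ennreal (exp (- (l * skewed_stable \<alpha> \<theta> w)) * exp (- w)) * indicator {0<..} w)"
        using AE_lborel_singleton[of "0::real"]
        by eventually_elim (auto simp: exponential_density_def indicator_def ennreal_mult mult_ac)
    qed
    also have "\<dots> = ?p \<theta> * ?J \<theta>" by (rule nn_integral_cmult) measurable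
    also have "\<dots> = ennreal (1 / pi) * (?J \<theta> * indicator {0<..<pi} \<theta>)"
      by (auto simp: indicator_def)
    finally show "(\<integral>\<^sup>+w. ?p \<theta> * ?q w * ?G \<theta> w \<partial>lborel)
        = ennreal (1 / pi) * (?J \<theta> * indicator {0<..<pi} \<theta>)" .
  qed
  also have "\<dots> = ennreal (1 / pi) * (\<integral>\<^sup>+\<theta>. ?J \<theta> * indicator {0<..<pi} \<theta> \<partial>lborel)"
    by (rule nn_integral_cmult) measurable
  also have "\<dots> \<le> ennreal (1 / pi) * ennreal (pi * exp (- (l powr \<alpha>)))"
    by (intro mult_left_mono nn_integral_skewed_stable_le a l) simp
  also have "\<dots> = ennreal (exp (- (l powr \<alpha>)))"
    by (simp add: ennreal_mult[symmetric])
  finally show ?thesis .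
qed

text \<open>The exponential of the sum factors into functions of independent pairs. The i-th factor
  is a Laplace transform at \<open>l * A i\<close>, and the exponents
  \<open>(l * A i) powr \<alpha>\<close> add up to the frequency moment times
  \<open>l powr \<alpha>\<close>.\<close>

lemma (in prob_space) projected_sample_laplace_le:
  fixes v w :: "nat \<Rightarrow> nat \<Rightarrow> 'a \<Rightarrow> real"
  assumes a: "0 < \<alpha>" "\<alpha> < 1" and l: "l \<ge> 0" and A: "\<And>i. i \<in> {1..D} \<Longrightarrow> A i \<ge> 0"
    and v: "\<And>i. i \<in> {1..D} \<Longrightarrow>
        distributed M lborel (v i j) (\<lambda>x. indicator {0<..<pi} x / measure lborel {0<..<pi})"
    and w: "\<And>i. i \<in> {1..D} \<Longrightarrow> distributed M lborel (w i j) (exponential_density 1)"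
    and ind: "indep_vars (\<lambda>_. borel) (case_sum (\<lambda>(i, j). v i j) (\<lambda>(i, j). w i j))
        (({1..D} \<times> {1..k}) <+> ({1..D} \<times> {1..k}))"
    and j: "j \<in> {1..k}"
  shows "(\<integral>\<^sup>+\<omega>. ennreal (exp (- (l * projected_sample \<alpha> D A v w j \<omega>))) \<partial>M)
     \<le> ennreal (exp (- (l powr \<alpha> * freq_moment \<alpha> D A)))"
proof -
  let ?Z = "case_sum (\<lambda>(i, j). v i j) (\<lambda>(i, j). w i j)"
  \<comment> \<open>The blocks \<open>K i\<close> pair the two variables that enter the i-th
    summand; they are disjoint, so functions of different blocks are independent.\<close>
  define K :: "nat \<Rightarrow> (nat \<times> nat + nat \<times> nat) set" where "K i = {Inl (i, j), Inr (i, j)}" for i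
  define Y :: "nat \<Rightarrow> (nat \<times> nat + nat \<times> nat \<Rightarrow> real) \<Rightarrow> ennreal" where
    "Y i f = ennreal (exp (- (l * A i * skewed_stable \<alpha> (f (Inl (i, j))) (f (Inr (i, j))))))"
        for i f
  have Y: "Y i \<in> borel_measurable (PiM (K i) (\<lambda>_. borel))" for i
    unfolding Y_def K_def by measurable
  have "indep_vars (\<lambda>i. PiM (K i) (\<lambda>_. borel)) (\<lambda>i \<omega>. restrict (\<lambda>x. ?Z x \<omega>) (K i)) {1..D}"
    by (rule indep_vars_restrict[OF ind]) (use j in \<open>auto simp: K_def disjoint_family_on_def\<close>)
  from indep_vars_compose2[OF this, of Y "\<lambda>_. borel"] Y
  have ind_Y: "indep_vars (\<lambda>_. borel) (\<lambda>i \<omega>. ennreal (exp (- (l * A i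
      * skewed_stable \<alpha> (v i j \<omega>) (w i j \<omega>))))) {1..D}"
    by (simp add: Y_def K_def)
  have ind_vw: "indep_var borel (v i j) borel (w i j)" if "i \<in> {1..D}" for i
  proof -
    let ?v = "Inl (i, j) :: nat \<times> nat + nat \<times> nat" and ?w = "Inr (i, j) :: nat \<times> nat + nat \<times> nat"
    have "indep_var (PiM {?v} (\<lambda>_. borel)) (\<lambda>\<omega>. restrict (\<lambda>x. ?Z x \<omega>) {?v})
        (PiM {?w} (\<lambda>_. borel)) (\<lambda>\<omega>. restrict (\<lambda>x. ?Z x \<omega>) {?w})"
      by (rule indep_var_restrict[OF ind]) (use that j in auto)
    from indep_var_compose[OF this, of "\<lambda>f. f ?v" borel "\<lambda>f. f ?w" borel]
    show ?thesis by (simp add: comp_def)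
  qed
  have "(\<integral>\<^sup>+\<omega>. ennreal (exp (- (l * projected_sample \<alpha> D A v w j \<omega>))) \<partial>M)
    = (\<integral>\<^sup>+\<omega>. (\<Prod>i\<in>{1..D}. ennreal (exp (- (l * A i * skewed_stable \<alpha> (v i j \<omega>) (w i j \<omega>))))) \<partial>M)"
    by (simp add: projected_sample_def prod_ennreal exp_sum[symmetric] sum_distrib_left sum_negf
        mult_ac)
  also have "\<dots> = (\<Prod>i\<in>{1..D}. \<integral>\<^sup>+\<omega>. ennreal (exp (- (l * A i
      * skewed_stable \<alpha> (v i j \<omega>) (w i j \<omega>)))) \<partial>M)"
    by (rule indep_vars_nn_integral[OF _ ind_Y]) auto
  also have "\<dots> \<le> (\<Prod>i\<in>{1..D}. ennreal (exp (- ((l * A i) powr \<alpha>))))"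
    using A l a by (intro prod_mono_ennreal skewed_stable_laplace_le v w ind_vw) auto
  also have "\<dots> = ennreal (exp (\<Sum>i\<in>{1..D}. - ((l * A i) powr \<alpha>)))"
    by (simp add: prod_ennreal exp_sum)
  also have "(\<Sum>i\<in>{1..D}. - ((l * A i) powr \<alpha>)) = - (l powr \<alpha> * freq_moment \<alpha> D A)"
    using A l by (auto simp: freq_moment_def sum_distrib_left sum_negf powr_mult intro!: sum.cong)
  finally show ?thesis .
qed

section \<open>Chernoff's bound and the minimum\<close>

text \<open>On the event, \<open>exp (l * (t - X \<omega>))\<close> is at least 1, so this
  exponential dominates the indicator everywhere.\<close>

lemma (in prob_space) prob_le_exp_mult_laplace:
  fixes X :: "'a \<Rightarrow> real"
  assumes [measurable]: "X \<in> borel_measurable M" and l: "l \<ge> 0"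
    and B: "(\<integral>\<^sup>+\<omega>. ennreal (exp (- (l * X \<omega>))) \<partial>M) \<le> ennreal b" "b \<ge> 0"
  shows "prob {\<omega> \<in> space M. X \<omega> \<le> t} \<le> exp (l * t) * b"
proof -
  have "emeasure M {\<omega> \<in> space M. X \<omega> \<le> t} = (\<integral>\<^sup>+\<omega>. indicator {\<omega> \<in> space M. X \<omega> \<le> t} \<omega> \<partial>M)"
    by simp
  also have "\<dots> \<le> (\<integral>\<^sup>+\<omega>. ennreal (exp (l * t)) * ennreal (exp (- (l * X \<omega>))) \<partial>M)"
  proof (intro nn_integral_mono)
    fix \<omega>
    have "1 \<le> exp (l * t) * exp (- (l * X \<omega>))" if "X \<omega> \<le> t"
      using mult_left_mono[OF that l] by (simp add: exp_add[symmetric])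
    then show "indicator {\<omega> \<in> space M. X \<omega> \<le> t} \<omega>
        \<le> ennreal (exp (l * t)) * ennreal (exp (- (l * X \<omega>)))"
      by (auto simp: indicator_def ennreal_mult[symmetric] simp del: ennreal_1
          simp flip: ennreal_1 intro: ennreal_leI)
  qed
  also have "\<dots> = ennreal (exp (l * t)) * (\<integral>\<^sup>+\<omega>. ennreal (exp (- (l * X \<omega>))) \<partial>M)"
    by (rule nn_integral_cmult) measurable
  also have "\<dots> \<le> ennreal (exp (l * t)) * ennreal b" by (intro mult_left_mono B) simp
  also have "\<dots> = ennreal (exp (l * t) * b)" using B by (simp add: ennreal_mult)
  finally show ?thesis using B by (simp add: emeasure_eq_measure)
qed

theorem theorem2:
  fixes M :: "'a measure"
    and D k :: nat
    and A :: "nat \<Rightarrow> real"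
    and \<alpha> \<epsilon> :: real
    and v w :: "nat \<Rightarrow> nat \<Rightarrow> 'a \<Rightarrow> real"
  assumes "prob_space M"
    and "D \<ge> 1" and "k \<ge> 1"
    and "\<And>i. i \<in> {1..D} \<Longrightarrow> A i \<ge> 0"
    and "\<exists>i\<in>{1..D}. A i \<noteq> 0"
    and "0 < \<alpha>" and "\<alpha> < 1"
    and "\<And>i j. i \<in> {1..D} \<Longrightarrow> j \<in> {1..k} \<Longrightarrow>
           distributed M lborel (v i j)
             (\<lambda>x. indicator {0<..<pi} x / measure lborel {0<..<pi})"
    and "\<And>i j. i \<in> {1..D} \<Longrightarrow> j \<in> {1..k} \<Longrightarrow>
           distributed M lborel (w i j) (exponential_density 1)"
    and "prob_space.indep_vars M (\<lambda>_. borel)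
           (case_sum (\<lambda>(i, j). v i j) (\<lambda>(i, j). w i j))
           (({1..D} \<times> {1..k}) <+> ({1..D} \<times> {1..k}))"
    and "0 < \<epsilon>" and "\<epsilon> < 1"
  shows "measure M {\<omega> \<in> space M.
             min_estimator \<alpha> D k A v w \<omega> \<le> (1 - \<epsilon>) * freq_moment \<alpha> D A}
           \<le> real k * exp (- ((1 - \<alpha>) * \<alpha> powr (1 / (1 - \<alpha>) - 1)
                               / (1 - \<epsilon>) powr (1 / (1 - \<alpha>))))"
proof -
  interpret prob_space M by fact
  define F where "F = freq_moment \<alpha> D A"
  define c where "c = 1 - \<epsilon>"
  define p where "p = 1 / (1 - \<alpha>)"
  \<comment> \<open>The threshold for a sample that corresponds to the threshold c F for its
    \<alpha>-th power.\<close>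
  define t where "t = (c * F) powr (1 / \<alpha>)"
  \<comment> \<open>the minimiser of \<open>l t - l powr \<alpha> F\<close>\<close>
  define l where "l = (\<alpha> / c) powr p / t"
  define E where "E = exp (- ((1 - \<alpha>) * \<alpha> powr (p - 1) / c powr p))"
  define X where "X = projected_sample \<alpha> D A v w"
  note a = \<open>0 < \<alpha>\<close> \<open>\<alpha> < 1\<close>
  obtain i0 where i0: "i0 \<in> {1..D}" "A i0 \<noteq> 0" using assms(5) by blast
  have F: "F > 0" unfolding F_def freq_moment_def
    by (rule sum_pos2[of _ i0]) (use i0 in auto)
  have c: "c > 0" using assms by (simp add: c_def)
  have t: "t > 0" using F c by (simp add: t_def)
  have l: "l > 0" using a c t by (simp add: l_def)
  have tF: "t powr \<alpha> = c * F" using a F c by (simp add: t_def powr_powr)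
  have "l powr \<alpha> = ((\<alpha> / c) powr p) powr \<alpha> / t powr \<alpha>"
    by (simp only: l_def powr_divide)
  then have "l powr \<alpha> * F = (\<alpha> / c) powr (p * \<alpha>) / c"
    unfolding tF powr_powr using c F by simp
  also have "p * \<alpha> = p - 1" using a by (simp add: p_def field_simps)
  also have "(\<alpha> / c) powr (p - 1) / c = \<alpha> powr (p - 1) / c powr p"
    using a c by (simp add: powr_divide powr_diff)
  finally have lF: "l powr \<alpha> * F = \<alpha> powr (p - 1) / c powr p" .
  have lt: "l * t = \<alpha> * (\<alpha> powr (p - 1) / c powr p)"
    using a c t by (simp add: l_def powr_divide powr_diff)
  \<comment> \<open>Both exponents are multiples of \<open>\<alpha> powr (p - 1) / c powr p\<close>,
    with factors \<alpha> and - 1; their sum produces the factor - (1 - \<alpha>).\<close>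
  have E: "exp (l * t) * exp (- (l powr \<alpha> * F)) = E"
    unfolding E_def exp_add[symmetric] lF lt by (simp add: algebra_simps diff_divide_distrib)
  have X_meas[measurable]: "X j \<in> borel_measurable M" if "j \<in> {1..k}" for j
    unfolding X_def projected_sample_def[abs_def]
    using that distributed_measurable[OF assms(8)] distributed_measurable[OF assms(9)]
    by (intro borel_measurable_sum borel_measurable_times measurable_skewed_stable) auto
  have P: "prob {\<omega> \<in> space M. X j \<omega> \<le> t} \<le> E" if j: "j \<in> {1..k}" for j
    unfolding E[symmetric] X_def F_def
    using projected_sample_laplace_le[OF a _ assms(4) assms(8)[OF _ j] assms(9)[OF _ j] assms(10)
        j, of l] l
      X_meas[OF j]
    by (intro prob_le_exp_mult_laplace) (auto simp: X_def)
  \<comment> \<open>The minimum is attained at some j, which reduces the event to a union over the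
    samples.\<close>
  have "{\<omega> \<in> space M. min_estimator \<alpha> D k A v w \<omega> \<le> c * F} \<subseteq> (\<Union>j\<in>{1..k}. {\<omega> \<in> space M. X j \<omega> \<le> t})"
  proof safe
    fix \<omega> assume w: "\<omega> \<in> space M" "min_estimator \<alpha> D k A v w \<omega> \<le> c * F"
    define m where "m = Min ((\<lambda>j. X j \<omega>) ` {1..k})"
    have "m \<in> (\<lambda>j. X j \<omega>) ` {1..k}" unfolding m_def using \<open>k \<ge> 1\<close> by (intro Min_in) auto
    moreover have "m \<le> t"
    \<comment> \<open>The power is inverted only for a positive base. The samples are positive
      merely almost surely, whereas the inclusion is pointwise; for m \<le> 0 it holds because t is
      positive.\<close>
    proof (cases "m \<le> 0")
      case False
      have "m powr \<alpha> \<le> c * F" using w by (simp add: min_estimator_def m_def X_def)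
      then have "(m powr \<alpha>) powr (1 / \<alpha>) \<le> t" unfolding t_def using a by (intro powr_mono2) auto
      then show ?thesis using False a by (simp add: powr_powr)
    qed (use t in simp)
    ultimately show "\<omega> \<in> (\<Union>j\<in>{1..k}. {\<omega> \<in> space M. X j \<omega> \<le> t})" using w by auto
  qed
  then have "prob {\<omega> \<in> space M. min_estimator \<alpha> D k A v w \<omega> \<le> c * F}
      \<le> prob (\<Union>j\<in>{1..k}. {\<omega> \<in> space M. X j \<omega> \<le> t})"
    by (rule finite_measure_mono) measurable
  also have "\<dots> \<le> (\<Sum>j\<in>{1..k}. prob {\<omega> \<in> space M. X j \<omega> \<le> t})"
    by (rule finite_measure_subadditive_finite) auto
  also have "\<dots> \<le> (\<Sum>j\<in>{1..k}. E)" by (intro sum_mono P)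
  also have "\<dots> = real k * E" by simp
  finally show ?thesis by (simp add: c_def F_def E_def p_def)
qed

end
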